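(* Let $0<r<\infty$ and $0<q<\infty$. Then there exists a sequence $\{f_k\}_{k\in\mathbb{Z}}$ with $f_k\in\mathcal{E}(2^k)$ for every $k\in\mathbb{Z}$ such that $$\sup_{P\in\mathcal{D}}\Big(\frac{1}{|P|}\int_P\sum_{k=-\log_2 l(P)}^{\infty}|f_k(x)|^q\,dx\Big)^{1/q}<\infty$$ but $$\sup_{P\in\mathcal{D}}\Big(\frac{1}{|P|}\int_P\sum_{k=-\log_2 l(P)}^{\infty}\big(\mathcal{M}_rf_k(x)\big)^q\,dx\Big)^{1/q}=\infty.$$
   Context: Everything is on $\mathbb{R}^d$, and the Fourier transform is $\widehat{f}(\xi)=\int_{\mathbb{R}^d}f(x)e^{-2\pi i\langle x,\xi\rangle}dx$. For $\rho>0$, $\mathcal{E}(\rho)$ is the space of tempered distributions on $\mathbb{R}^d$ whose Fourier transforms are supported in $\{\xi:|\xi|\le 2\rho\}$ (such distributions are identified with smooth functions). $\mathcal{D}$ is the set of all dyadic cubes in $\mathbb{R}^d$ and $l(P)$ is the side length of $P\in\mathcal{D}$. The Hardy-Littlewood maximal operator is $\mathcal{M}f(x)=\sup_{x\in Q}\frac{1}{|Q|}\int_Q|f(y)|\,dy$, the supremum being over all cubes $Q$ containing $x$, and for $0<r<\infty$, $\mathcal{M}_rf:=\big(\mathcal{M}(|f|^r)\big)^{1/r}$. *)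

theory Defs
  imports "HOL-Analysis.Analysis"
begin

section \<open>Schwartz functions and tempered distributions\<close>

definition partial_deriv :: "'n::finite \<Rightarrow> (real^'n \<Rightarrow> complex) \<Rightarrow> real^'n \<Rightarrow> complex" where
  "partial_deriv i f = (\<lambda>x. frechet_derivative f (at x) (axis i 1))"

text \<open>Iterated derivatives are indexed by lists of coordinates rather than by multi-indices; for
  smooth functions the order of the list is irrelevant.\<close>

definition iter_partial :: "'n::finite list \<Rightarrow> (real^'n \<Rightarrow> complex) \<Rightarrow> real^'n \<Rightarrow> complex" where
  "iter_partial is f = foldr partial_deriv is f"

definition smooth :: "(real^'n::finite \<Rightarrow> complex) \<Rightarrow> bool" where
  "smooth f \<longleftrightarrow> (\<forall>is x. iter_partial is f differentiable (at x))"

definition monomial_deriv ::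
    "('n::finite \<Rightarrow> nat) \<Rightarrow> 'n list \<Rightarrow> (real^'n \<Rightarrow> complex) \<Rightarrow> real^'n \<Rightarrow> complex" where
  "monomial_deriv \<alpha> is f x = of_real (\<Prod>i\<in>UNIV. (x $ i) ^ \<alpha> i) * iter_partial is f x"

definition schwartz :: "(real^'n::finite \<Rightarrow> complex) set" where
  "schwartz = {\<phi>. smooth \<phi> \<and> (\<forall>\<alpha> is. bounded (range (monomial_deriv \<alpha> is \<phi>)))}"

definition schwartz_seminorm ::
    "('n::finite \<Rightarrow> nat) \<Rightarrow> 'n list \<Rightarrow> (real^'n \<Rightarrow> complex) \<Rightarrow> real" where
  "schwartz_seminorm \<alpha> is \<phi> = (SUP x. norm (monomial_deriv \<alpha> is \<phi> x))"

text \<open>Only the values of \<open>u\<close> on Schwartz functions are meaningful. Continuity is domination by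
  finitely many Schwartz seminorms.\<close>

definition tempered_distribution :: "((real^'n::finite \<Rightarrow> complex) \<Rightarrow> complex) \<Rightarrow> bool" where
  "tempered_distribution u \<longleftrightarrow>
     (\<forall>\<phi>\<in>schwartz. \<forall>\<psi>\<in>schwartz. u (\<lambda>x. \<phi> x + \<psi> x) = u \<phi> + u \<psi>) \<and>
     (\<forall>\<phi>\<in>schwartz. \<forall>c. u (\<lambda>x. c * \<phi> x) = c * u \<phi>) \<and>
     (\<exists>F C. finite F \<and>
        (\<forall>\<phi>\<in>schwartz. norm (u \<phi>) \<le> C * (\<Sum>(\<alpha>, is)\<in>F. schwartz_seminorm \<alpha> is \<phi>)))"

definition fourier :: "(real^'n::finite \<Rightarrow> complex) \<Rightarrow> real^'n \<Rightarrow> complex" where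
  "fourier f \<xi> = (LINT x|lborel. f x * exp (- 2 * of_real pi * \<i> * of_real (x \<bullet> \<xi>)))"

definition fourier_distribution ::
    "((real^'n::finite \<Rightarrow> complex) \<Rightarrow> complex) \<Rightarrow> (real^'n \<Rightarrow> complex) \<Rightarrow> complex" where
  "fourier_distribution u = (\<lambda>\<phi>. u (fourier \<phi>))"

definition test_functions :: "(real^'n::finite) set \<Rightarrow> (real^'n \<Rightarrow> complex) set" where
  "test_functions U =
     {\<phi>. smooth \<phi> \<and> compact (closure {x. \<phi> x \<noteq> 0}) \<and> closure {x. \<phi> x \<noteq> 0} \<subseteq> U}"

definition distribution_support ::
    "((real^'n::finite \<Rightarrow> complex) \<Rightarrow> complex) \<Rightarrow> (real^'n) set" where
  "distribution_support u = - \<Union>{U. open U \<and> (\<forall>\<phi>\<in>test_functions U. u \<phi> = 0)}"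

definition represents ::
    "(real^'n::finite \<Rightarrow> complex) \<Rightarrow> ((real^'n \<Rightarrow> complex) \<Rightarrow> complex) \<Rightarrow> bool" where
  "represents f u \<longleftrightarrow>
     (\<forall>\<phi>\<in>schwartz. integrable lborel (\<lambda>x. f x * \<phi> x) \<and> u \<phi> = (LINT x|lborel. f x * \<phi> x))"

text \<open>A tempered distribution with compactly supported Fourier transform is given by a unique
  smooth function (of polynomial growth); the space consists of these functions.\<close>

definition band_limited :: "real \<Rightarrow> (real^'n::finite \<Rightarrow> complex) set" where
  "band_limited \<rho> =
     {f. smooth f \<and>
         (\<exists>u. tempered_distribution u \<and> represents f u \<and>
              distribution_support (fourier_distribution u) \<subseteq> {\<xi>. norm \<xi> \<le> 2 * \<rho>})}"

section \<open>Cubes and maximal operators\<close>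

definition ennpowr :: "ennreal \<Rightarrow> real \<Rightarrow> ennreal" where
  "ennpowr x a = (if x = \<infinity> then \<infinity> else ennreal (enn2real x powr a))" \<comment> \<open>intended for \<open>a > 0\<close>\<close>

text \<open>Cubes have sides parallel to the axes. The cubes of the maximal operator are closed and
  nondegenerate, the dyadic ones half-open.\<close>

definition cubes :: "(real^'n::finite) set set" where
  "cubes = {cbox a (\<chi> i. a $ i + l) | a l. 0 < l}"

definition half_open_cube :: "real^'n::finite \<Rightarrow> real \<Rightarrow> (real^'n) set" where
  "half_open_cube a l = {x. \<forall>i. a $ i \<le> x $ i \<and> x $ i < a $ i + l}"

definition dyadic_cubes :: "(real^'n::finite) set set" where
  "dyadic_cubes =
     {half_open_cube (\<chi> i. of_int (m i) * 2 powi j) (2 powi j) | (m :: 'n \<Rightarrow> int) (j :: int). True}"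

definition side_length :: "(real^'n::finite) set \<Rightarrow> real" where
  "side_length P = (THE l. 0 < l \<and> (\<exists>a. P = half_open_cube a l))"

definition average :: "(real^'n::finite) set \<Rightarrow> (real^'n \<Rightarrow> ennreal) \<Rightarrow> ennreal" where
  "average Q g = (\<integral>\<^sup>+y\<in>Q. g y \<partial>lborel) / emeasure lborel Q"

definition maximal :: "(real^'n::finite \<Rightarrow> 'b::real_normed_vector) \<Rightarrow> real^'n \<Rightarrow> ennreal" where
  "maximal f x = (SUP Q\<in>{Q\<in>cubes. x \<in> Q}. average Q (\<lambda>y. ennreal (norm (f y))))"

definition maximal_r ::
    "real \<Rightarrow> (real^'n::finite \<Rightarrow> 'b::real_normed_vector) \<Rightarrow> real^'n \<Rightarrow> ennreal" where
  "maximal_r r f x = ennpowr (maximal (\<lambda>y. norm (f y) powr r) x) (1 / r)"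

text \<open>The supremum over dyadic cubes \<open>P\<close> of
  \<open>(1/|P| \<integral>\<^sub>P \<Sum>\<^sub>k g\<^sub>k(x)\<^sup>q dx)\<^sup>1\<^sup>/\<^sup>q\<close>, \<open>k\<close> running over the integers
  \<open>k \<ge> - log\<^sub>2 l(P)\<close>.\<close>

definition dyadic_sup :: "real \<Rightarrow> (int \<Rightarrow> real^'n::finite \<Rightarrow> ennreal) \<Rightarrow> ennreal" where
  "dyadic_sup q g =
     (SUP P\<in>dyadic_cubes.
        ennpowr
          (average P (\<lambda>x. \<Sum>\<^sub>\<infinity>k\<in>{k. - log 2 (side_length P) \<le> of_int k}. ennpowr (g k x) q))
          (1 / q))"

end

theory Submission
  imports Defs "HOL-Probability.Sinc_Integral" "HOL-Complex_Analysis.Cauchy_Integral_Formula"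
begin

text \<open>Take \<open>\<psi>(t) = sin\<^sup>3 t / t\<^sup>2\<close>, and for \<open>k \<ge> 0\<close> let \<open>f\<^sub>k\<close> be the tensor power of \<open>\<psi>\<close> dilated by
  \<open>2\<^sup>k\<close>, up to a dimensional constant; \<open>f\<^sub>k = 0\<close> for \<open>k < 0\<close>. These functions live at scale \<open>2\<^sup>k\<close>
  instead of the scale \<open>2\<^sup>-\<^sup>k\<close> that their band would permit. Since \<open>\<psi>\<close> vanishes at \<open>0\<close> and decays at
  infinity, \<open>\<Sum>\<^sub>k |f\<^sub>k(x)|\<^sup>q\<close> is bounded uniformly in \<open>x\<close>; but every \<open>f\<^sub>k\<close> is of size about one on a
  fixed proportion of the cube \<open>[0, C 2\<^sup>k]\<^sup>d\<close>, so all the maximal functions are bounded below on the unit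
  cube.\<close>

section \<open>A band-limited profile\<close>

text \<open>Combines \<open>(sin t)\<^sup>2 \<le> t\<^sup>2\<close> with
  \<open>(sin t)\<^sup>2 \<le> 1\<close>. The right-hand side is an integrable majorant on the whole
  line.\<close>

lemma sinc_bound: "(sinc t)\<^sup>2 \<le> 2 * inverse (1 + t\<^sup>2)"
proof (cases "t = 0")
  case False
  have "(sin t)\<^sup>2 \<le> 1" by (simp add: abs_square_le_1)
  moreover have "(sin t)\<^sup>2 \<le> t\<^sup>2" using abs_sin_x_le_abs_x[of t] by (simp add: abs_le_square_iff)
  moreover have "(sin t)\<^sup>2 * t\<^sup>2 \<le> 1 * t\<^sup>2" using calculation by (intro mult_right_mono) auto
  ultimately have "(sin t)\<^sup>2 * (1 + t\<^sup>2) \<le> 2 * t\<^sup>2" by (simp add: algebra_simps)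
  moreover have "0 < 1 + t\<^sup>2" by (simp add: add_pos_nonneg)
  ultimately show ?thesis using False
    by (simp add: field_simps power_divide)
qed simp

lemma integrable_inverse_1_plus_square': "integrable lborel (\<lambda>t::real. inverse (1 + t\<^sup>2))"
  using integrable_inverse_1_plus_square by (simp add: set_integrable_def)

lemma integrable_sinc_sq_mult:
  fixes h :: "real \<Rightarrow> real"
  assumes [measurable]: "h \<in> borel_measurable borel" and h: "\<And>t. \<bar>h t\<bar> \<le> 1"
  shows "integrable lborel (\<lambda>t. (sinc t)\<^sup>2 * h t)"
proof (rule Bochner_Integration.integrable_bound)
  show "integrable lborel (\<lambda>t::real. 2 * inverse (1 + t\<^sup>2))"
    using integrable_inverse_1_plus_square' by simp
  show "AE t in lborel. norm ((sinc t)\<^sup>2 * h t) \<le> norm (2 * inverse (1 + t\<^sup>2))"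
  proof (rule AE_I2)
    fix t :: real
    have "norm ((sinc t)\<^sup>2 * h t) = (sinc t)\<^sup>2 * \<bar>h t\<bar>"
      by (metis abs_mult abs_power2 real_norm_def)
    also have "\<dots> \<le> (sinc t)\<^sup>2 * 1" by (intro mult_left_mono h) auto
    also have "\<dots> \<le> 2 * inverse (1 + t\<^sup>2)" using sinc_bound[of t] by simp
    finally show "norm ((sinc t)\<^sup>2 * h t) \<le> norm (2 * inverse (1 + t\<^sup>2))"
      by (simp add: abs_mult)
  qed
qed measurable

lemma Si_uminus: "Si (- x) = - Si x"
  using Si_neg[of x] Si_neg[of "- x"] by (cases "0 \<le> x") auto

text \<open>The boundary term of an integration by parts. Division by zero gives
  \<open>(sin t)\<^sup>2 / t\<close> its continuous value at \<open>0\<close>, so differentiability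
  holds there too: by Caratheodory's criterion, \<open>(sinc t)\<^sup>2\<close> is the slope
  function at \<open>0\<close>.\<close>

lemma DERIV_sin_sq_over: "((\<lambda>t. (sin t)\<^sup>2 / t) has_real_derivative 2 * cos t * sinc t - (sinc t)\<^sup>2) (at t)"
proof (cases "t = 0")
  case True
  have "isCont (\<lambda>t. (sinc t)\<^sup>2) 0" by (intro continuous_power isCont_sinc)
  moreover have "\<forall>z. (sin z)\<^sup>2 / z - (sin 0)\<^sup>2 / 0 = (sinc z)\<^sup>2 * (z - 0)"
    by (auto simp: power2_eq_square)
  ultimately have "((\<lambda>t. (sin t)\<^sup>2 / t) has_real_derivative 1) (at 0)"
    unfolding CARAT_DERIV by (intro exI[of _ "\<lambda>t. (sinc t)\<^sup>2"]) auto
  then show ?thesis using True by simp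
next
  case False
  then show ?thesis
    by (auto intro!: derivative_eq_intros simp: power2_eq_square field_simps)
qed

text \<open>The left-hand side is the derivative of \<open>Si (a * t)\<close>. Away from
  \<open>t = 0\<close> this puts all such terms over the common denominator \<open>t\<close>,
  whatever the sign of \<open>a\<close>.\<close>

lemma sinc_scale: "a * sinc (a * t) = (if t = 0 then a else sin (a * t) / t)"
  by auto

text \<open>Up to a factor, \<open>sinc\<close> is the Fourier transform of the indicator of [-1,1],
  so the transform of its square is a triangle supported in [-2,2]. The vanishing outside is
  verified directly, by the fundamental theorem of calculus on the whole line.\<close>

lemma fejer_fourier_real:
  assumes "2 < \<bar>a\<bar>"
  shows "(LINT t|lborel. (sinc t)\<^sup>2 * cos (a * t)) = 0"
proof -
  define w where "w = \<bar>a\<bar>"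
  have w: "2 < w" using assms by (simp add: w_def)
  \<comment> \<open>\<open>G\<close> is the odd antiderivative of the integrand, obtained by parts. At infinity its \<open>Si\<close> terms
    cancel because \<open>2 < w\<close> makes \<open>w + 2\<close> and \<open>w - 2\<close> both positive.\<close>
  define G where "G t = (Si ((2 + w) * t) + Si ((2 - w) * t)) / 2 - w / 2 * Si (w * t)
     + w / 4 * (Si ((w + 2) * t) + Si ((w - 2) * t)) - (sin t)\<^sup>2 / t * cos (w * t)" for t
  have dSi: "((\<lambda>t. Si (c * t)) has_real_derivative (c * sinc (c * t))) (at t)" for c t
    using DERIV_chain2[OF DERIV_Si DERIV_cmult_Id] by (simp only: mult.commute[of c "sinc _"])
  \<comment> \<open>Product-to-sum formulas: they turn the two terms left by the integration by
    parts into the sums of sines which, divided by \<open>t\<close>, are the derivatives of the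
    \<open>Si\<close> terms of \<open>G\<close>.\<close>
  have trig1: "2 * (sin t * cos t) * cos (w * t) = (sin ((2 + w) * t) + sin ((2 - w) * t)) / 2" for t
    by (simp add: distrib_right left_diff_distrib sin_add sin_diff sin_double)
  have trig2: "(sin t)\<^sup>2 * sin (w * t) = sin (w * t) / 2 - (sin ((w + 2) * t) + sin ((w - 2) * t)) / 4" for t
  proof -
    have "sin ((w + 2) * t) + sin ((w - 2) * t) = 2 * (sin (w * t) * cos (2 * t))"
      by (simp add: distrib_right left_diff_distrib sin_add sin_diff)
    also have "cos (2 * t) = 1 - 2 * (sin t)\<^sup>2" by (rule cos_double_sin)
    finally have "sin ((w + 2) * t) + sin ((w - 2) * t) = 2 * (sin (w * t) * (1 - 2 * (sin t)\<^sup>2))" .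
    then show ?thesis by (simp only:) (simp add: field_simps)
  qed
  have dG: "(G has_real_derivative (sinc t)\<^sup>2 * cos (w * t)) (at t)" for t
  proof -
    have "(G has_real_derivative
        (((2 + w) * sinc ((2 + w) * t)) + ((2 - w) * sinc ((2 - w) * t))) / 2 - w / 2 * (w * sinc (w * t))
        + w / 4 * ((w + 2) * sinc ((w + 2) * t) + (w - 2) * sinc ((w - 2) * t))
        - ((2 * cos t * sinc t - (sinc t)\<^sup>2) * cos (w * t) + (- sin (w * t) * w) * ((sin t)\<^sup>2 / t))) (at t)"
      unfolding G_def
      by (intro DERIV_add DERIV_diff DERIV_mult DERIV_cmult DERIV_cdivide dSi DERIV_sin_sq_over)
         (auto intro!: derivative_eq_intros)
    also have "(((2 + w) * sinc ((2 + w) * t)) + ((2 - w) * sinc ((2 - w) * t))) / 2 - w / 2 * (w * sinc (w * t))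
        + w / 4 * ((w + 2) * sinc ((w + 2) * t) + (w - 2) * sinc ((w - 2) * t))
        - ((2 * cos t * sinc t - (sinc t)\<^sup>2) * cos (w * t) + (- sin (w * t) * w) * ((sin t)\<^sup>2 / t))
        = (sinc t)\<^sup>2 * cos (w * t)"
    proof (cases "t = 0")
      case True
      then show ?thesis by (simp add: sinc_scale algebra_simps)
    next
      case False
      have "(((2 + w) * sinc ((2 + w) * t)) + ((2 - w) * sinc ((2 - w) * t))) / 2
          = 2 * (sin t * cos t) * cos (w * t) / t"
        unfolding trig1 sinc_scale using False by (simp add: add_divide_distrib)
      moreover have "w / 2 * (w * sinc (w * t)) - w / 4 * ((w + 2) * sinc ((w + 2) * t) + (w - 2) * sinc ((w - 2) * t))
          = w * ((sin t)\<^sup>2 * sin (w * t)) / t"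
        unfolding trig2 sinc_scale using False by (simp add: field_simps)
      ultimately show ?thesis using False by (simp add: algebra_simps)
    qed
    finally show ?thesis .
  qed
  have Si_lim: "((\<lambda>t. Si (c * t)) \<longlongrightarrow> pi / 2) at_top" if "0 < c" for c
    by (intro filterlim_compose[OF Si_at_top] filterlim_tendsto_pos_mult_at_top[OF tendsto_const that] filterlim_ident)
  have Si_lim': "((\<lambda>t. Si ((2 - w) * t)) \<longlongrightarrow> - (pi / 2)) at_top"
    using tendsto_minus[OF Si_lim[of "w - 2"]] w by (simp add: Si_uminus[symmetric] algebra_simps)
  have U: "((\<lambda>t. (sin t)\<^sup>2 / t * cos (w * t)) \<longlongrightarrow> 0) at_top"
  proof (rule Lim_null_comparison)
    show "\<forall>\<^sub>F t in at_top. norm ((sin t)\<^sup>2 / t * cos (w * t)) \<le> 1 / t"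
      using eventually_gt_at_top[of 0]
    proof eventually_elim
      case (elim t)
      have "(sin t)\<^sup>2 * \<bar>cos (w * t)\<bar> \<le> 1 * 1" by (intro mult_mono) (auto simp: abs_square_le_1)
      then show ?case using elim by (simp add: abs_mult divide_right_mono)
    qed
    show "((\<lambda>t::real. 1 / t) \<longlongrightarrow> 0) at_top"
      by (intro tendsto_divide_0[OF tendsto_const] filterlim_at_top_imp_at_infinity filterlim_ident)
  qed
  have Gtop: "(G \<longlongrightarrow> 0) at_top"
  proof -
    have "(G \<longlongrightarrow> (pi / 2 + - (pi / 2)) / 2 - w / 2 * (pi / 2) + w / 4 * (pi / 2 + pi / 2) - 0) at_top"
      unfolding G_def using w by (intro tendsto_intros Si_lim Si_lim' U) auto
    then show ?thesis by (simp add: field_simps)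
  qed
  have Godd: "G (- t) = - G t" for t
    unfolding G_def by (simp add: Si_uminus) (simp add: field_simps)
  have Gbot: "(G \<longlongrightarrow> 0) at_bot"
    unfolding filterlim_at_bot_mirror Godd using tendsto_minus[OF Gtop] by simp
  have int: "integrable lborel (\<lambda>t. (sinc t)\<^sup>2 * cos (w * t))"
    by (rule integrable_sinc_sq_mult) auto
  have "(LBINT t=-\<infinity>..\<infinity>. (sinc t)\<^sup>2 * cos (w * t)) = 0 - 0"
  proof (rule interval_integral_FTC_integrable)
    show "(G has_vector_derivative (sinc t)\<^sup>2 * cos (w * t)) (at t)" for t
      using dG by (simp add: has_real_derivative_iff_has_vector_derivative)
    show "isCont (\<lambda>t. (sinc t)\<^sup>2 * cos (w * t)) t" for t
      by (intro continuous_mult continuous_power isCont_sinc) auto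
    show "set_integrable lborel (einterval (-\<infinity>) \<infinity>) (\<lambda>t. (sinc t)\<^sup>2 * cos (w * t))"
      using int by (simp add: set_integrable_def)
    show "((G \<circ> real_of_ereal) \<longlongrightarrow> 0) (at_right (-\<infinity>))" "((G \<circ> real_of_ereal) \<longlongrightarrow> 0) (at_left \<infinity>)"
      using Gbot Gtop by (simp_all add: ereal_tendsto_simps)
  qed simp
  then have "(LINT t|lborel. (sinc t)\<^sup>2 * cos (w * t)) = 0"
    by (simp add: interval_lebesgue_integral_def set_lebesgue_integral_def)
  moreover have "cos (w * t) = cos (a * t)" for t
    by (simp add: w_def abs_if)
  ultimately show ?thesis by simp
qed

section \<open>The profile: size bounds, spectrum and analytic continuation\<close>

definition wavelet :: "real \<Rightarrow> real" where
  "wavelet t = sin t ^ 3 / t ^ 2" \<comment> \<open>division by zero gives the correct value at \<open>0\<close>\<close>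

lemma wavelet_eq: "wavelet t = (sinc t)\<^sup>2 * sin t"
  by (simp add: wavelet_def power2_eq_square power3_eq_cube)

lemma continuous_wavelet: "isCont wavelet t"
  unfolding wavelet_eq[abs_def] by (intro continuous_mult continuous_power isCont_sinc) auto

lemma borel_measurable_wavelet [measurable]: "wavelet \<in> borel_measurable borel"
  by (intro borel_measurable_continuous_onI continuous_at_imp_continuous_on ballI continuous_wavelet)

lemma integrable_wavelet: "integrable lborel wavelet"
  unfolding wavelet_eq[abs_def] by (rule integrable_sinc_sq_mult) auto

text \<open>The second bound is used for dilations much larger than \<open>t\<close>, the third for
  much smaller ones. The first disposes of the remaining factors in a tensor product.\<close>

lemma wavelet_le: "\<bar>wavelet t\<bar> \<le> 1" "\<bar>wavelet t\<bar> \<le> \<bar>t\<bar>" "t \<noteq> 0 \<Longrightarrow> \<bar>wavelet t\<bar> \<le> 1 / \<bar>t\<bar>"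
proof -
  have s: "\<bar>sinc t\<bar> \<le> 1" using abs_sin_x_le_abs_x[of t] by (auto simp: field_simps)
  have s2: "(sinc t)\<^sup>2 \<le> 1" using s by (metis abs_square_le_1)
  have e: "\<bar>wavelet t\<bar> = (sinc t)\<^sup>2 * \<bar>sin t\<bar>" unfolding wavelet_eq
    by (metis abs_mult abs_power2)
  show "\<bar>wavelet t\<bar> \<le> 1" unfolding e using s2 mult_mono[OF s2, of "\<bar>sin t\<bar>" 1] by simp
  show "\<bar>wavelet t\<bar> \<le> \<bar>t\<bar>" unfolding e
    using mult_mono[OF s2 abs_sin_x_le_abs_x[of t]] by simp
  assume t: "t \<noteq> 0"
  have "\<bar>wavelet t\<bar> = \<bar>sin t\<bar> ^ 2 * \<bar>sinc t\<bar> / \<bar>t\<bar>"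
    using t by (simp add: wavelet_def abs_mult power2_eq_square power3_eq_cube)
  moreover have "\<bar>sin t\<bar> ^ 2 * \<bar>sinc t\<bar> \<le> 1 * 1"
    by (intro mult_mono s) (auto simp: abs_square_le_1)
  ultimately show "\<bar>wavelet t\<bar> \<le> 1 / \<bar>t\<bar>"
    by (metis abs_ge_zero divide_right_mono mult_1)
qed

text \<open>Multiplication by \<open>sin t\<close> translates the spectrum [-2,2] of
  \<open>(sinc t)\<^sup>2\<close> by 1 and by -1, so the spectrum of the profile lies in [-3,3]. The
  cosine part of the integral vanishes because the profile is odd.\<close>

lemma wavelet_fourier:
  assumes "3 < \<bar>w\<bar>"
  shows "(LINT t|lborel. complex_of_real (wavelet t) * exp (- \<i> * of_real (w * t))) = 0"
proof -
  have int: "integrable lborel (\<lambda>t. wavelet t * cos (w * t))" "integrable lborel (\<lambda>t. wavelet t * sin (w * t))"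
    unfolding wavelet_eq mult.assoc
    by (rule integrable_sinc_sq_mult; simp add: abs_mult mult_le_one)+
  have odd: "(LINT t|lborel. wavelet t * cos (w * t)) = 0"
  proof -
    have "(LINT t|lborel. wavelet t * cos (w * t)) = (LINT t|lborel. wavelet (- t) * cos (w * (- t)))"
      using lborel_integral_real_affine[of "-1" "\<lambda>t. wavelet t * cos (w * t)" 0] by simp
    also have "\<dots> = - (LINT t|lborel. wavelet t * cos (w * t))"
      by (simp add: wavelet_def)
    finally show ?thesis by simp
  qed
  have "(LINT t|lborel. wavelet t * sin (w * t))
      = (LINT t|lborel. (sinc t)\<^sup>2 * cos ((w - 1) * t) / 2 - (sinc t)\<^sup>2 * cos ((w + 1) * t) / 2)"
    unfolding wavelet_eq
    by (intro Bochner_Integration.integral_cong refl)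
       (simp add: distrib_right left_diff_distrib cos_add cos_diff field_simps)
  also have "\<dots> = 0"
    using assms fejer_fourier_real[of "w - 1"] fejer_fourier_real[of "w + 1"]
      integrable_sinc_sq_mult[of "\<lambda>t. cos ((w - 1) * t)"] integrable_sinc_sq_mult[of "\<lambda>t. cos ((w + 1) * t)"]
    by (subst Bochner_Integration.integral_diff) (auto simp del: mult_eq_0_iff)
  finally have even: "(LINT t|lborel. wavelet t * sin (w * t)) = 0" .
  have "complex_of_real (wavelet t) * exp (- \<i> * of_real (w * t))
     = of_real (wavelet t * cos (w * t)) - \<i> * of_real (wavelet t * sin (w * t))" for t
  proof -
    have "exp (- \<i> * of_real (w * t)) = cis (- (w * t))" by (simp add: cis_conv_exp)
    then show ?thesis by (simp add: complex_eq_iff)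
  qed
  then have "(LINT t|lborel. complex_of_real (wavelet t) * exp (- \<i> * of_real (w * t)))
     = of_real (LINT t|lborel. wavelet t * cos (w * t)) - \<i> * of_real (LINT t|lborel. wavelet t * sin (w * t))"
    using int by (simp del: of_real_mult)
  then show ?thesis using odd even by simp
qed

text \<open>The singularity at \<open>0\<close> is removable, and the convention for division by
  zero already assigns the right value. The profile thus extends to an entire function, which yields
  smoothness without computing real derivatives.\<close>

lemma sin_cube_over_square_holomorphic: "(\<lambda>z::complex. sin z ^ 3 / z ^ 2) holomorphic_on UNIV"
proof -
  let ?s = "\<lambda>z::complex. if z = 0 then 1 else sin z / z"
  have "deriv sin (0::complex) = 1" by (rule DERIV_imp_deriv) (auto intro!: derivative_eq_intros)
  then have "?s holomorphic_on UNIV"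
    by (intro pole_theorem_0[where g = sin and a = 0 and f = ?s] holomorphic_on_sin holomorphic_on_ident) simp_all
  then have "(\<lambda>z. sin z * ?s z ^ 2) holomorphic_on UNIV"
    by (intro holomorphic_intros)
  moreover have "(\<lambda>z. sin z * ?s z ^ 2) = (\<lambda>z::complex. sin z ^ 3 / z ^ 2)"
    by (auto simp: power2_eq_square power3_eq_cube)
  ultimately show ?thesis by simp
qed

section \<open>Band-limited functions\<close>

text \<open>Here \<open>D i n\<close> plays the part of the \<open>n\<close>-th derivative of the
  \<open>i\<close>-th factor. Arbitrary orders \<open>m\<close> are allowed so that the result can
  be iterated.\<close>

lemma has_derivative_prod_components:
  fixes D :: "'n::finite \<Rightarrow> nat \<Rightarrow> real \<Rightarrow> complex"
  assumes "\<And>i n t. (D i n has_vector_derivative D i (Suc n) t) (at t)"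
  shows "((\<lambda>x. \<Prod>i\<in>UNIV. D i (m i) (x $ i)) has_derivative
     (\<lambda>h. \<Sum>i\<in>UNIV. (h $ i *\<^sub>R D i (Suc (m i)) (x $ i)) * (\<Prod>j\<in>UNIV - {i}. D j (m j) (x $ j)))) (at x)"
proof (rule has_derivative_prod)
  fix i :: 'n
  have c: "((\<lambda>x::real^'n. x $ i) has_derivative (\<lambda>h. h $ i)) (at x)"
    by (rule bounded_linear.has_derivative[OF bounded_linear_vec_nth]) (rule has_derivative_ident)
  show "((\<lambda>x. D i (m i) (x $ i)) has_derivative (\<lambda>h. h $ i *\<^sub>R D i (Suc (m i)) (x $ i))) (at x)"
    using has_derivative_compose[OF c, of "D i (m i)"] assms[of i "m i" "x $ i"]
    by (simp add: has_vector_derivative_def)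
qed

text \<open>A partial derivative in direction \<open>a\<close> raises the order of the factor
  \<open>a\<close> alone, so that order is the number of occurrences of \<open>a\<close> in the
  list.\<close>

lemma iter_partial_prod_components:
  fixes D :: "'n::finite \<Rightarrow> nat \<Rightarrow> real \<Rightarrow> complex"
  assumes D: "\<And>i n t. (D i n has_vector_derivative D i (Suc n) t) (at t)"
  shows "iter_partial is (\<lambda>x. \<Prod>i\<in>UNIV. D i 0 (x $ i)) = (\<lambda>x. \<Prod>i\<in>UNIV. D i (count_list is i) (x $ i))"
proof (induction "is")
  case Nil
  then show ?case by (simp add: iter_partial_def)
next
  case (Cons a "is")
  let ?m = "count_list is"
  have "iter_partial (a # is) (\<lambda>x. \<Prod>i\<in>UNIV. D i 0 (x $ i))
      = partial_deriv a (\<lambda>x. \<Prod>i\<in>UNIV. D i (?m i) (x $ i))"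
    using Cons by (simp add: iter_partial_def)
  also have "\<dots> = (\<lambda>x. \<Prod>i\<in>UNIV. D i (count_list (a # is) i) (x $ i))"
  proof
    fix x :: "real^'n"
    have "partial_deriv a (\<lambda>x. \<Prod>i\<in>UNIV. D i (?m i) (x $ i)) x
      = (\<Sum>i\<in>UNIV. (axis a 1 $ i *\<^sub>R D i (Suc (?m i)) (x $ i)) * (\<Prod>j\<in>UNIV - {i}. D j (?m j) (x $ j)))"
      unfolding partial_deriv_def
      by (subst frechet_derivative_at[OF has_derivative_prod_components[of D, OF D, of ?m x], symmetric]) simp
    also have "\<dots> = (\<Sum>i\<in>UNIV. if i = a then D i (Suc (?m i)) (x $ i) * (\<Prod>j\<in>UNIV - {i}. D j (?m j) (x $ j)) else 0)"
      by (intro sum.cong) (auto simp: axis_def)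
    also have "\<dots> = D a (Suc (?m a)) (x $ a) * (\<Prod>j\<in>UNIV - {a}. D j (?m j) (x $ j))"
      by simp
    also have "(\<Prod>j\<in>UNIV - {a}. D j (?m j) (x $ j)) = (\<Prod>j\<in>UNIV - {a}. D j (count_list (a # is) j) (x $ j))"
      by (intro prod.cong) auto
    also have "D a (Suc (?m a)) (x $ a) * \<dots> = (\<Prod>i\<in>UNIV. D i (count_list (a # is) i) (x $ i))"
      by (subst prod.remove[of UNIV a]) auto
    finally show "partial_deriv a (\<lambda>x. \<Prod>i\<in>UNIV. D i (?m i) (x $ i)) x
      = (\<Prod>i\<in>UNIV. D i (count_list (a # is) i) (x $ i))" .
  qed
  finally show ?case .
qed

text \<open>Complex derivatives of an entire function, restricted to the real axis, are its real
  derivatives there. They supply the family \<open>D\<close> for the preceding product rule.\<close>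

lemma smooth_prod_holomorphic:
  fixes F :: "'n::finite \<Rightarrow> complex \<Rightarrow> complex"
  assumes "\<And>i. F i holomorphic_on UNIV"
  shows "smooth (\<lambda>x::real^'n. \<Prod>i\<in>UNIV. F i (of_real (x $ i)))"
proof -
  define D where "D i n t = (deriv ^^ n) (F i) (complex_of_real t)" for i n t
  have D: "(D i n has_vector_derivative D i (Suc n) t) (at t)" for i n t
  proof -
    have "(deriv ^^ n) (F i) holomorphic_on UNIV"
      by (intro holomorphic_higher_deriv assms) auto
    then have "((deriv ^^ n) (F i) has_field_derivative deriv ((deriv ^^ n) (F i)) (of_real t)) (at (of_real t))"
      by (intro holomorphic_derivI[of _ UNIV]) auto
    from has_vector_derivative_real_field[OF this] show ?thesis
      by (simp add: D_def[abs_def])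
  qed
  have "iter_partial is (\<lambda>x::real^'n. \<Prod>i\<in>UNIV. D i 0 (x $ i)) differentiable (at x)" for "is" x
    unfolding iter_partial_prod_components[of D, OF D] differentiable_def
    by (rule exI, rule has_derivative_prod_components[of D, OF D])
  then show ?thesis by (simp add: smooth_def D_def)
qed

section \<open>Integrals and Fourier transforms of tensor products\<close>

lemma smooth_imp_continuous: "smooth f \<Longrightarrow> continuous_on S f"
  unfolding smooth_def
  by (intro continuous_at_imp_continuous_on ballI differentiable_imp_continuous_within)
     (drule spec[of _ "[]"], simp add: iter_partial_def)

lemma smooth_imp_borel_measurable: "smooth f \<Longrightarrow> f \<in> borel_measurable borel"
  by (intro borel_measurable_continuous_onI smooth_imp_continuous)

text \<open>Lebesgue measure on \<open>real^'n\<close> is the image of the product measure indexed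
  by \<open>Basis\<close>, where Fubini for products applies; \<open>axis_index\<close> translates
  basis vectors back into coordinates.\<close>

lemma lborel_prod_components:
  fixes g :: "'n::finite \<Rightarrow> real \<Rightarrow> complex"
  assumes g: "\<And>i. integrable lborel (g i)"
  shows "integrable lborel (\<lambda>x::real^'n. \<Prod>i\<in>UNIV. g i (x $ i))"
    and "(LINT x|lborel. (\<Prod>i\<in>UNIV. g i ((x::real^'n) $ i))) = (\<Prod>i\<in>UNIV. LINT t|lborel. g i t)"
proof -
  interpret product_sigma_finite "\<lambda>_::real^'n. lborel :: real measure" by standard
  have [measurable]: "g i \<in> borel_measurable borel" for i
    using borel_measurable_integrable[OF g] by simp
  have Basis: "(Basis :: (real^'n) set) = range (\<lambda>i. axis i 1)"
    by (auto simp: Basis_vec_def)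
  have inj: "inj (\<lambda>i::'n. axis i (1::real))" by (auto simp: inj_on_def axis_eq_axis)
  let ?f = "\<lambda>x::real^'n. \<Prod>i\<in>UNIV. g i (x $ i)"
  have m: "?f \<in> borel_measurable borel" by measurable
  have T: "(\<lambda>f. \<Sum>b\<in>Basis. f b *\<^sub>R b) \<in> measurable (\<Pi>\<^sub>M b\<in>(Basis::(real^'n) set). lborel) borel"
    by measurable
  have eq: "?f (\<Sum>b\<in>Basis. h b *\<^sub>R b) = (\<Prod>b\<in>Basis. g (axis_index b) (h b))" for h :: "real^'n \<Rightarrow> real"
  proof -
    have "(\<Sum>b\<in>Basis. h b *\<^sub>R b) $ i = h (axis i 1)" for i
    proof -
      have "(\<Sum>b\<in>Basis. h b *\<^sub>R b) $ i = (\<Sum>b\<in>Basis. h b *\<^sub>R b) \<bullet> axis i 1"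
        by (simp add: inner_axis)
      then show ?thesis by (subst (asm) inner_sum_left_Basis) auto
    qed
    then show ?thesis by (simp add: Basis prod.reindex[OF inj])
  qed
  have "integrable (\<Pi>\<^sub>M b\<in>(Basis::(real^'n) set). lborel) (\<lambda>h. \<Prod>b\<in>Basis. g (axis_index b) (h b))"
    by (intro product_integrable_prod g) auto
  then show "integrable lborel ?f"
    by (subst lborel_eq, subst integrable_distr_eq[OF T m]) (simp only: eq)
  have "(LINT x|lborel. ?f x) = (LINT h|(\<Pi>\<^sub>M b\<in>(Basis::(real^'n) set). lborel). (\<Prod>b\<in>Basis. g (axis_index b) (h b)))"
    by (subst lborel_eq, subst integral_distr[OF T m]) (simp only: eq)
  also have "\<dots> = (\<Prod>b\<in>(Basis::(real^'n) set). LINT t|lborel. g (axis_index b) t)"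
    by (intro product_integral_prod g) auto
  also have "\<dots> = (\<Prod>i\<in>UNIV. LINT t|lborel. g i t)"
    by (simp add: Basis prod.reindex[OF inj])
  finally show "(LINT x|lborel. ?f x) = (\<Prod>i\<in>UNIV. LINT t|lborel. g i t)" .
qed

text \<open>The exponential kernel is itself a product over the coordinates.\<close>

lemma fourier_prod_components:
  fixes g :: "'n::finite \<Rightarrow> real \<Rightarrow> complex"
  assumes g: "\<And>i. integrable lborel (g i)"
  shows "fourier (\<lambda>x. \<Prod>i\<in>UNIV. g i (x $ i)) \<xi>
    = (\<Prod>i\<in>UNIV. LINT t|lborel. g i t * exp (- \<i> * of_real (2 * pi * \<xi> $ i * t)))"
proof -
  have [measurable]: "g i \<in> borel_measurable borel" for i
    using borel_measurable_integrable[OF g] by simp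
  have "integrable lborel (\<lambda>t. g i t * exp (- \<i> * of_real (2 * pi * \<xi> $ i * t)))" for i
    by (rule Bochner_Integration.integrable_bound[OF g[of i]]) (auto simp: norm_mult)
  note * = lborel_prod_components(2)[of "\<lambda>i t. g i t * exp (- \<i> * of_real (2 * pi * \<xi> $ i * t))", OF this]
  have "(\<Prod>i\<in>UNIV. g i (x $ i)) * exp (- 2 * of_real pi * \<i> * of_real (x \<bullet> \<xi>))
    = (\<Prod>i\<in>UNIV. g i (x $ i) * exp (- \<i> * of_real (2 * pi * \<xi> $ i * x $ i)))" for x
    by (simp add: prod.distrib exp_sum[symmetric] inner_vec_def sum_distrib_left mult_ac flip: sum_negf)
  then show ?thesis unfolding fourier_def using * by simp
qed

lemma integrable_bounded_mult:
  fixes f g :: "'a::euclidean_space \<Rightarrow> complex"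
  assumes f: "integrable lborel f" and g[measurable]: "g \<in> borel_measurable borel"
    and bd: "\<And>x. norm (g x) \<le> B"
  shows "integrable lborel (\<lambda>x. f x * g x)" and "norm (LINT x|lborel. f x * g x) \<le> B * (LINT x|lborel. norm (f x))"
proof -
  have [measurable]: "f \<in> borel_measurable borel" using borel_measurable_integrable[OF f] by simp
  have B: "0 \<le> B" using bd norm_ge_zero order_trans by blast
  have le: "norm (f x * g x) \<le> B * norm (f x)" for x
    using mult_left_mono[OF bd[of x] norm_ge_zero[of "f x"]] by (simp add: norm_mult mult.commute)
  have i: "integrable lborel (\<lambda>x. B * norm (f x))" using f by auto
  show "integrable lborel (\<lambda>x. f x * g x)"
    by (rule Bochner_Integration.integrable_bound[OF i]) (use le B in \<open>auto simp: abs_mult\<close>)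
  show "norm (LINT x|lborel. f x * g x) \<le> B * (LINT x|lborel. norm (f x))"
    using Bochner_Integration.integral_norm_bound_integral[OF \<open>integrable lborel (\<lambda>x. f x * g x)\<close> i le] by simp
qed

text \<open>The multiplication formula, by Fubini. It identifies the distributional Fourier
  transform of an integrable function with the pointwise one.\<close>

lemma integral_fourier_swap:
  fixes f \<phi> :: "real^'n::finite \<Rightarrow> complex"
  assumes f: "integrable lborel f" and \<phi>: "integrable lborel \<phi>"
  shows "(LINT x|lborel. f x * fourier \<phi> x) = (LINT \<xi>|lborel. fourier f \<xi> * \<phi> \<xi>)"
proof -
  have [measurable]: "f \<in> borel_measurable borel" "\<phi> \<in> borel_measurable borel"
    using borel_measurable_integrable[OF f] borel_measurable_integrable[OF \<phi>] by simp_all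
  let ?h = "\<lambda>x \<xi>::real^'n. f x * \<phi> \<xi> * exp (- 2 * of_real pi * \<i> * of_real (x \<bullet> \<xi>))"
  have n: "norm (?h x \<xi>) = norm (f x) * norm (\<phi> \<xi>)" for x \<xi>
    by (simp add: norm_mult)
  have "integrable (lborel \<Otimes>\<^sub>M lborel) (case_prod ?h)"
  proof (rule lborel_pair.Fubini_integrable)
    show "case_prod ?h \<in> borel_measurable (lborel \<Otimes>\<^sub>M lborel)"
      by measurable
    show "integrable lborel (\<lambda>x. LINT y|lborel. norm (case_prod ?h (x, y)))"
      unfolding case_prod_conv n using f \<phi> by simp
    show "AE x in lborel. integrable lborel (\<lambda>y. case_prod ?h (x, y))"
    proof (rule AE_I2)
      fix x
      have "integrable lborel (\<lambda>y. norm (f x) * norm (\<phi> y))" using \<phi> by auto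
      then show "integrable lborel (\<lambda>y. case_prod ?h (x, y))"
        unfolding case_prod_conv
        by (rule Bochner_Integration.integrable_bound) (use n in auto)
    qed
  qed
  then have "(LINT \<xi>|lborel. LINT x|lborel. ?h x \<xi>) = (LINT x|lborel. LINT \<xi>|lborel. ?h x \<xi>)"
    by (rule lborel_pair.Fubini_integral)
  moreover have "(LINT \<xi>|lborel. ?h x \<xi>) = f x * fourier \<phi> x" for x
    unfolding fourier_def by (simp add: inner_commute mult.assoc)
  moreover have "(LINT x|lborel. ?h x \<xi>) = fourier f \<xi> * \<phi> \<xi>" for \<xi>
    unfolding fourier_def
    by (subst integral_mult_left_zero[symmetric]) (simp add: mult_ac)
  ultimately show ?thesis by simp
qed

lemma integrable_test_function: "\<phi> \<in> test_functions U \<Longrightarrow> integrable lborel \<phi>"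
proof -
  assume \<phi>: "\<phi> \<in> test_functions U"
  let ?K = "closure {x. \<phi> x \<noteq> 0}"
  have "integrable lborel (\<lambda>x. indicator ?K x *\<^sub>R \<phi> x)"
    using \<phi> by (intro borel_integrable_compact smooth_imp_continuous) (auto simp: test_functions_def)
  moreover have "(\<lambda>x. indicator ?K x *\<^sub>R \<phi> x) = \<phi>"
    using closure_subset[of "{x. \<phi> x \<noteq> 0}"] by (fastforce simp: indicator_def)
  ultimately show ?thesis by simp
qed

section \<open>Integrable functions as tempered distributions\<close>

lemma schwartz_norm_le_seminorm:
  assumes "\<phi> \<in> schwartz"
  shows "norm (\<phi> x) \<le> schwartz_seminorm (\<lambda>_. 0) [] \<phi>"
proof -
  have e: "monomial_deriv (\<lambda>_. 0) [] \<phi> = \<phi>"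
    by (simp add: monomial_deriv_def[abs_def] iter_partial_def)
  have "bounded (range \<phi>)" using assms e unfolding schwartz_def by (metis (mono_tags, lifting) mem_Collect_eq)
  then have "bdd_above (range (\<lambda>x. norm (\<phi> x)))" by (auto simp: bounded_iff bdd_above_def)
  then show ?thesis unfolding schwartz_seminorm_def e by (intro cSUP_upper) auto
qed

text \<open>Integration against \<open>f\<close> is continuous for the sup norm, which is the
  seminorm without weight or derivative; the constant is the L1 norm of \<open>f\<close>. By the
  multiplication formula, the distributional transform kills every test function supported outside
  the ball.\<close>

lemma band_limitedI:
  fixes f :: "real^'n::finite \<Rightarrow> complex"
  assumes smooth: "smooth f" and int: "integrable lborel f"
    and vanish: "\<And>\<xi>. 2 * \<rho> < norm \<xi> \<Longrightarrow> fourier f \<xi> = 0"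
  shows "f \<in> band_limited \<rho>"
proof -
  define u where "u \<phi> = (LINT x|lborel. f x * \<phi> x)" for \<phi>
  have bd: "integrable lborel (\<lambda>x. f x * \<phi> x)"
       "norm (u \<phi>) \<le> schwartz_seminorm (\<lambda>_. 0) [] \<phi> * (LINT x|lborel. norm (f x))" if "\<phi> \<in> schwartz" for \<phi>
  proof -
    have "\<phi> \<in> borel_measurable borel"
      using that by (intro smooth_imp_borel_measurable) (simp add: schwartz_def)
    note integrable_bounded_mult[OF int this schwartz_norm_le_seminorm[OF that]]
    then show "integrable lborel (\<lambda>x. f x * \<phi> x)"
       "norm (u \<phi>) \<le> schwartz_seminorm (\<lambda>_. 0) [] \<phi> * (LINT x|lborel. norm (f x))"
      by (simp_all add: u_def)
  qed
  have "tempered_distribution u"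
    unfolding tempered_distribution_def
  proof (intro conjI ballI allI)
    show "u (\<lambda>x. \<phi> x + \<psi> x) = u \<phi> + u \<psi>" if "\<phi> \<in> schwartz" "\<psi> \<in> schwartz" for \<phi> \<psi>
      using bd(1)[OF that(1)] bd(1)[OF that(2)] by (simp add: u_def distrib_left)
    show "u (\<lambda>x. c * \<phi> x) = c * u \<phi>" if "\<phi> \<in> schwartz" for c \<phi>
      by (simp add: u_def mult.left_commute[of _ c])
    show "\<exists>F C. finite F \<and> (\<forall>\<phi>\<in>schwartz. norm (u \<phi>) \<le> C * (\<Sum>(\<alpha>, is)\<in>F. schwartz_seminorm \<alpha> is \<phi>))"
      using bd(2)
      by (intro exI[of _ "{(\<lambda>_. 0, [])}"] exI[of _ "LINT x|lborel. norm (f x)"]) (auto simp: mult.commute)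
  qed
  moreover have "represents f u"
    using bd(1) by (auto simp: represents_def u_def)
  moreover have "distribution_support (fourier_distribution u) \<subseteq> {\<xi>. norm \<xi> \<le> 2 * \<rho>}"
  proof -
    let ?U = "{\<xi>::real^'n. 2 * \<rho> < norm \<xi>}"
    have "fourier_distribution u \<phi> = 0" if "\<phi> \<in> test_functions ?U" for \<phi>
    proof -
      have "\<phi> \<xi> = 0 \<or> 2 * \<rho> < norm \<xi>" for \<xi>
        using that closure_subset[of "{x. \<phi> x \<noteq> 0}"] by (auto simp: test_functions_def)
      then have "(\<lambda>\<xi>. fourier f \<xi> * \<phi> \<xi>) = (\<lambda>_. 0)" using vanish by (metis mult_eq_0_iff)
      then show ?thesis
        using integral_fourier_swap[OF int integrable_test_function[OF that]]
        by (simp add: fourier_distribution_def u_def)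
    qed
    moreover have "open ?U" by (intro open_Collect_less continuous_intros)
    ultimately show ?thesis
      unfolding distribution_support_def by (auto simp: not_less[symmetric])
  qed
  ultimately show ?thesis unfolding band_limited_def using smooth by blast
qed

section \<open>Spectrum of the dilated tensor powers\<close>

lemma wavelet_zero [simp]: "wavelet 0 = 0"
  by (simp add: wavelet_def)

lemma norm_prod_wavelet:
  "norm (\<Prod>i\<in>UNIV. complex_of_real (wavelet ((x::real^'n::finite) $ i / c))) = (\<Prod>i\<in>UNIV. \<bar>wavelet (x $ i / c)\<bar>)"
  by (simp add: prod_norm[symmetric])

text \<open>Since \<open>k\<close> is a natural number, dilation by \<open>2 ^ k\<close> shrinks the
  spectrum while the permitted ball grows, which leaves ample room. It suffices that one factor of
  the transform vanishes.\<close>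

lemma band_limited_wavelet:
  fixes k :: nat
  shows "(\<lambda>x::real^'n::finite. \<Prod>i\<in>UNIV. complex_of_real (wavelet (x $ i / (real CARD('n) * 2 ^ k))))
    \<in> band_limited (2 ^ k)"
proof -
  define l where "l = real CARD('n) * 2 ^ k"
  have l: "0 < l" by (simp add: l_def)
  let ?g = "\<lambda>t. complex_of_real (wavelet (t / l))"
  let ?f = "\<lambda>x::real^'n. \<Prod>i\<in>UNIV. ?g (x $ i)"
  have g: "integrable lborel ?g"
    using lborel_integrable_real_affine[OF integrable_wavelet, of "1 / l" 0] l by simp
  have "?f \<in> band_limited (2 ^ k)"
  proof (rule band_limitedI)
    have "(\<lambda>z::complex. z / l) holomorphic_on UNIV"
      using l by (intro holomorphic_intros) auto
    then have "(\<lambda>z::complex. sin (z / l) ^ 3 / (z / l) ^ 2) holomorphic_on UNIV"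
      using holomorphic_on_compose_gen[OF _ sin_cube_over_square_holomorphic] by (simp add: o_def)
    then have "smooth (\<lambda>x::real^'n. \<Prod>i\<in>UNIV. (\<lambda>z. sin (z / l) ^ 3 / (z / l) ^ 2) (complex_of_real (x $ i)))"
      by (rule smooth_prod_holomorphic)
    moreover have "sin (complex_of_real t / l) ^ 3 / (complex_of_real t / l) ^ 2 = ?g t" for t
      using sin_of_real[of "t / l", where 'a = complex] by (simp add: wavelet_def)
    ultimately show "smooth ?f" by simp
    show "integrable lborel ?f"
      by (rule lborel_prod_components) (rule g)
    fix \<xi> :: "real^'n"
    assume "2 * 2 ^ k < norm \<xi>"
    also have "norm \<xi> \<le> (\<Sum>i\<in>UNIV. \<bar>\<xi> $ i\<bar>)" by (rule norm_le_l1_cart)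
    \<comment> \<open>A pigeonhole argument on the l1 norm finds one large coordinate. The loss of a
      factor \<open>CARD('n)\<close> is offset by the same factor in \<open>l\<close>.\<close>
    finally have "\<exists>i. 2 * 2 ^ k / real CARD('n) < \<bar>\<xi> $ i\<bar>"
    proof (rule contrapos_pp)
      assume "\<nexists>i. 2 * 2 ^ k / real CARD('n) < \<bar>\<xi> $ i\<bar>"
      then have "(\<Sum>i\<in>UNIV. \<bar>\<xi> $ i\<bar>) \<le> real CARD('n) * (2 * 2 ^ k / real CARD('n))"
        by (intro sum_bounded_above) (auto simp: not_less)
      then show "\<not> 2 * 2 ^ k < (\<Sum>i\<in>UNIV. \<bar>\<xi> $ i\<bar>)" by simp
    qed
    then obtain i where i: "2 * 2 ^ k < \<bar>\<xi> $ i\<bar> * real CARD('n)"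
      by (auto simp: field_simps)
    define w where "w = 2 * pi * \<xi> $ i * l"
    \<comment> \<open>Crude estimates suffice: with \<open>2 \<le> pi\<close> they give a rescaled
      frequency above 8, whereas 3 is needed.\<close>
    have "2 * 1 \<le> 2 * (2::real) ^ k * 2 ^ k"
      by (intro mult_mono) (auto simp: mult_ge1_I)
    also have "\<dots> < \<bar>\<xi> $ i\<bar> * real CARD('n) * 2 ^ k"
      using i by (intro mult_strict_right_mono) auto
    also have "\<dots> = \<bar>\<xi> $ i\<bar> * l" by (simp add: l_def)
    finally have "2 < \<bar>\<xi> $ i\<bar> * l" by simp
    moreover have "2 \<le> pi" by (rule pi_ge_two)
    ultimately have "2 * 2 * 2 < 2 * pi * (\<bar>\<xi> $ i\<bar> * l)"
      by (intro mult_le_less_imp_less) auto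
    moreover have "\<bar>w\<bar> = 2 * pi * (\<bar>\<xi> $ i\<bar> * l)" using l by (simp add: w_def abs_mult)
    ultimately have "3 < \<bar>w\<bar>" by linarith
    then have "(LINT t|lborel. complex_of_real (wavelet t) * exp (- \<i> * of_real (w * t))) = 0"
      by (rule wavelet_fourier)
    then have "(LINT t|lborel. ?g t * exp (- \<i> * of_real (2 * pi * \<xi> $ i * t))) = 0"
      using lborel_integral_real_affine[of l "\<lambda>t. ?g t * exp (- \<i> * of_real (2 * pi * \<xi> $ i * t))" 0] l
      by (simp add: w_def mult.assoc)
    then show "fourier ?f \<xi> = 0"
      using fourier_prod_components[of "\<lambda>_. ?g" \<xi>, OF g] by (auto simp: prod_zero_iff)
  qed
  then show ?thesis by (simp add: l_def)
qed

lemma band_limited_zero: "(\<lambda>_::real^'n::finite. 0) \<in> band_limited \<rho>"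
proof (rule band_limitedI)
  show "smooth (\<lambda>_::real^'n. 0)"
    using smooth_prod_holomorphic[of "\<lambda>_::'n. \<lambda>_. 0"] by (simp add: power_0_left)
qed (simp_all add: fourier_def)

section \<open>Dyadic summation\<close>

text \<open>On either side of \<open>m\<close> the distance to \<open>m\<close> is injective, so
  each half is part of a geometric series. The bound depends neither on \<open>F\<close> nor on
  \<open>m\<close>.\<close>

lemma sum_power_distance_le:
  fixes a :: real
  assumes a: "0 < a" "a < 1" and F: "finite F"
  shows "(\<Sum>k\<in>F. a ^ nat \<bar>k - m\<bar>) \<le> 2 / (1 - a)"
proof -
  have half: "(\<Sum>k\<in>G. a ^ nat \<bar>k - m\<bar>) \<le> 1 / (1 - a)"
    if G: "finite G" and inj: "inj_on (\<lambda>k. nat \<bar>k - m\<bar>) G" for G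
  proof -
    have "(\<Sum>k\<in>G. a ^ nat \<bar>k - m\<bar>) = (\<Sum>n\<in>(\<lambda>k. nat \<bar>k - m\<bar>) ` G. a ^ n)"
      by (simp add: sum.reindex[OF inj])
    also have "\<dots> \<le> (\<Sum>n. a ^ n)"
      using a G by (intro sum_le_suminf) (auto intro!: summable_geometric)
    finally show ?thesis using a by (simp add: suminf_geometric)
  qed
  have "(\<Sum>k\<in>F. a ^ nat \<bar>k - m\<bar>) = (\<Sum>k\<in>{k\<in>F. m \<le> k}. a ^ nat \<bar>k - m\<bar>) + (\<Sum>k\<in>{k\<in>F. k < m}. a ^ nat \<bar>k - m\<bar>)"
    using F by (subst sum.union_disjoint[symmetric]) (auto intro!: sum.cong)
  also have "\<dots> \<le> 1 / (1 - a) + 1 / (1 - a)"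
    using F by (intro add_mono half) (auto simp: inj_on_def)
  finally show ?thesis by simp
qed

text \<open>The floor \<open>m\<close> of the logarithm satisfies
  \<open>2 powr m \<le> \<bar>t\<bar> < 2 powr (m + 1)\<close>. For \<open>k \<ge> m\<close> the
  zero of the profile at \<open>0\<close> gives the decay, for \<open>k < m\<close> its decay at
  infinity. The factor 2 comes from the upper bound on \<open>\<bar>t\<bar>\<close>.\<close>

lemma wavelet_dyadic_decay:
  assumes "t \<noteq> 0"
  shows "\<bar>wavelet (t / 2 powi k)\<bar> \<le> 2 * (1 / 2) ^ nat \<bar>k - \<lfloor>log 2 \<bar>t\<bar>\<rfloor>\<bar>"
proof -
  define m where "m = \<lfloor>log 2 \<bar>t\<bar>\<rfloor>"
  have p: "2 powi j = 2 powr real_of_int j" for j :: int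
    by (simp add: powr_real_of_int')
  have m: "2 powr m \<le> \<bar>t\<bar>" "\<bar>t\<bar> < 2 powr (m + 1)"
    using assms le_log_iff[of 2 "\<bar>t\<bar>" m] log_less_iff[of 2 "\<bar>t\<bar>" "m + 1"] by (auto simp: m_def)
  have h: "(1 / 2) ^ n = 2 powr (- real n)" for n
    by (simp add: powr_minus powr_realpow power_one_over inverse_eq_divide)
  show ?thesis
  proof (cases "m \<le> k")
    case True
    have "\<bar>wavelet (t / 2 powi k)\<bar> \<le> \<bar>t / 2 powi k\<bar>" by (rule wavelet_le)
    also have "\<dots> \<le> 2 powr (m + 1) / 2 powr k"
      using m unfolding p abs_divide by (intro divide_mono) auto
    also have "\<dots> = 2 * 2 powr (- real (nat \<bar>k - m\<bar>))"
      using True by (simp add: powr_add powr_diff powr_minus field_simps)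
    finally show ?thesis unfolding h m_def .
  next
    case False
    have "\<bar>wavelet (t / 2 powi k)\<bar> \<le> 1 / \<bar>t / 2 powi k\<bar>" using assms by (intro wavelet_le) auto
    also have "\<dots> = 2 powr k / \<bar>t\<bar>" by (simp add: p)
    also have "\<dots> \<le> 2 powr k / 2 powr m" using m by (intro divide_left_mono) (auto simp: assms)
    also have "\<dots> = 2 powr (- real (nat \<bar>k - m\<bar>))"
      using False by (simp add: powr_diff powr_minus field_simps)
    also have "\<dots> \<le> 2 * \<dots>" by simp
    finally show ?thesis unfolding h m_def .
  qed
qed

text \<open>The \<open>q\<close>-th powers of the dyadic bounds form a two-sided geometric series of
  ratio \<open>(1 / 2) powr q\<close> centred at the scale of \<open>t\<close>. Its sum does not see
  the centre, so the bound is uniform in \<open>t\<close>.\<close>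

lemma wavelet_dyadic_sum_bounded:
  assumes q: "0 < q" and F: "finite F"
  shows "(\<Sum>k\<in>F. \<bar>wavelet (t / 2 powi k)\<bar> powr q) \<le> 2 powr q * (2 / (1 - (1 / 2) powr q))"
proof (cases "t = 0")
  \<comment> \<open>At \<open>t = 0\<close> there is no scale to centre at, but every summand is
    zero; only the sign of the bound has to be checked.\<close>
  case True
  have "(1 / 2) powr q < (1::real)" using powr_less_mono2[OF q, of "1 / 2" 1] by simp
  then show ?thesis using True by simp
next
  case False
  define m where "m = \<lfloor>log 2 \<bar>t\<bar>\<rfloor>"
  have a: "(1 / 2) powr q < (1::real)" using powr_less_mono2[OF q, of "1 / 2" 1] by simp
  have "(\<Sum>k\<in>F. \<bar>wavelet (t / 2 powi k)\<bar> powr q) \<le> (\<Sum>k\<in>F. 2 powr q * ((1 / 2) powr q) ^ nat \<bar>k - m\<bar>)"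
  proof (rule sum_mono)
    fix k
    have "\<bar>wavelet (t / 2 powi k)\<bar> powr q \<le> (2 * (1 / 2) ^ nat \<bar>k - m\<bar>) powr q"
      unfolding m_def using q by (intro powr_mono2 wavelet_dyadic_decay False) auto
    also have "\<dots> = 2 powr q * ((1 / 2) powr q) ^ nat \<bar>k - m\<bar>"
      by (simp add: powr_mult powr_power powr_powr mult.commute flip: powr_realpow)
    finally show "\<bar>wavelet (t / 2 powi k)\<bar> powr q \<le> 2 powr q * ((1 / 2) powr q) ^ nat \<bar>k - m\<bar>" .
  qed
  also have "\<dots> \<le> 2 powr q * (2 / (1 - (1 / 2) powr q))"
    unfolding sum_distrib_left[symmetric]
    using a F by (intro mult_left_mono sum_power_distance_le) auto
  finally show ?thesis .
qed

section \<open>Averages and suprema over cubes\<close>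

lemma ennpowr_ennreal: "0 \<le> x \<Longrightarrow> ennpowr (ennreal x) a = ennreal (x powr a)"
  by (simp add: ennpowr_def)

lemma ennpowr_mono:
  assumes "x \<le> y" "0 \<le> a"
  shows "ennpowr x a \<le> ennpowr y a"
proof (cases "y = \<infinity>")
  case False
  then have "x \<noteq> \<infinity>" using assms(1) by (auto simp: top_unique)
  then show ?thesis using False assms
    by (auto simp: ennpowr_def intro!: ennreal_leI powr_mono2 enn2real_mono simp: less_top)
qed (simp add: ennpowr_def)

lemma sets_half_open_cube [measurable]: "half_open_cube a l \<in> sets (borel :: (real^'n::finite) measure)"
  unfolding half_open_cube_def by measurable

lemma average_le_const:
  assumes [measurable]: "Q \<in> sets borel" and g: "\<And>y. g y \<le> c"
  shows "average Q g \<le> c"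
proof -
  have "(\<integral>\<^sup>+y\<in>Q. g y \<partial>lborel) \<le> (\<integral>\<^sup>+y. c * indicator Q y \<partial>lborel)"
    using g by (intro nn_integral_mono) (auto simp: indicator_def)
  also have "\<dots> = c * emeasure lborel Q" by (simp add: nn_integral_cmult_indicator)
  finally have "average Q g \<le> c * emeasure lborel Q / emeasure lborel Q"
    unfolding average_def by (rule divide_right_mono_ennreal)
  \<comment> \<open>If the measure of \<open>Q\<close> is zero or infinite, the quotient is
    \<open>0\<close> by the conventions for \<open>ennreal\<close>.\<close>
  also have "\<dots> \<le> c"
    by (cases "emeasure lborel Q = 0 \<or> emeasure lborel Q = top")
       (auto simp: mult_divide_eq_ennreal)
  finally show ?thesis .
qed

lemma average_ge_const:
  assumes [measurable]: "R \<in> sets borel" and R: "R \<subseteq> Q" and g: "\<And>y. y \<in> R \<Longrightarrow> c \<le> g y"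
  shows "c * emeasure lborel R / emeasure lborel Q \<le> average Q g"
proof -
  have "c * emeasure lborel R = (\<integral>\<^sup>+y. c * indicator R y \<partial>lborel)" by (simp add: nn_integral_cmult_indicator)
  also have "\<dots> \<le> (\<integral>\<^sup>+y\<in>Q. g y \<partial>lborel)"
    using g R by (intro nn_integral_mono) (auto simp: indicator_def)
  finally show ?thesis unfolding average_def by (rule divide_right_mono_ennreal)
qed

lemma emeasure_lborel_cube:
  fixes a :: "real^'n::finite"
  assumes "0 \<le> l"
  shows "emeasure lborel (cbox a (\<chi> i. a $ i + l)) = ennreal (l ^ CARD('n))"
proof -
  have eq: "((\<chi> i. a $ i + l) - a) \<bullet> b = l" if "b \<in> Basis" for b :: "real^'n"
    using that by (auto simp: Basis_vec_def inner_axis)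
  then have "a \<bullet> b \<le> (\<chi> i. a $ i + l) \<bullet> b" if "b \<in> Basis" for b :: "real^'n"
    using that assms by (metis diff_ge_0_iff_ge inner_diff_left)
  then have "emeasure lborel (cbox a (\<chi> i. a $ i + l)) = (\<Prod>b\<in>(Basis::(real^'n) set). ((\<chi> i. a $ i + l) - a) \<bullet> b)"
    by (rule emeasure_lborel_cbox)
  also have "\<dots> = ennreal (l ^ CARD('n))"
    using eq by simp
  finally show ?thesis .
qed

lemma side_length_half_open_cube:
  assumes l: "0 < l"
  shows "side_length (half_open_cube (a :: real^'n::finite) l) = l"
  unfolding side_length_def
proof (rule the_equality)
  fix l' assume "0 < l' \<and> (\<exists>b. half_open_cube a l = half_open_cube b l')"
  then obtain b where l': "0 < l'" and b: "\<And>x. x \<in> half_open_cube a l \<longleftrightarrow> x \<in> half_open_cube b l'"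
    by auto
  have "a \<in> half_open_cube b l'" using l b[of a] by (simp add: half_open_cube_def)
  moreover have "b \<in> half_open_cube a l" using l' b[of b] by (simp add: half_open_cube_def)
  ultimately have ab: "a $ i = b $ i" for i by (auto simp: half_open_cube_def intro: antisym)
  \<comment> \<open>The corners agree, as each lies in the cube of the other. If the sides differed,
    the point displaced by the smaller side in every coordinate would lie in the longer cube
    only.\<close>
  show "l' = l"
    using b[of "\<chi> i. a $ i + min l l'"] l l' by (auto simp: half_open_cube_def ab min_def split: if_splits)
qed (use l in auto)

text \<open>A pointwise bound is more than the averages require. In \<open>ennreal\<close> an
  infinite sum is the supremum of its finite partial sums, so the bound passes to every index set,
  then to averages and to the supremum.\<close>

lemma dyadic_sup_finite:
  fixes g :: "int \<Rightarrow> real^'n::finite \<Rightarrow> ennreal"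
  assumes q: "0 < q" and bd: "\<And>x F. finite F \<Longrightarrow> (\<Sum>k\<in>F. ennpowr (g k x) q) \<le> ennreal C"
  shows "dyadic_sup q g < \<infinity>"
proof -
  have inf: "(\<Sum>\<^sub>\<infinity>k\<in>A. ennpowr (g k x) q) \<le> ennreal C" for A x
    by (subst nonneg_infsum_complete) (auto intro!: SUP_least bd)
  have "dyadic_sup q g \<le> ennpowr (ennreal C) (1 / q)"
    unfolding dyadic_sup_def
  proof (rule SUP_least)
    fix P :: "(real^'n) set" assume "P \<in> dyadic_cubes"
    then have "P \<in> sets borel" by (auto simp: dyadic_cubes_def)
    then show "ennpowr (average P (\<lambda>x. \<Sum>\<^sub>\<infinity>k\<in>{k. - log 2 (side_length P) \<le> of_int k}. ennpowr (g k x) q)) (1 / q)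
        \<le> ennpowr (ennreal C) (1 / q)"
      using q by (intro ennpowr_mono average_le_const inf) auto
  qed
  also have "\<dots> < \<infinity>" by (simp add: ennpowr_def)
  finally show ?thesis .
qed

text \<open>The unit cube alone suffices: its side has logarithm \<open>0\<close>, so
  \<open>k\<close> runs over all nonnegative integers, and infinitely many summands are at least
  \<open>c powr q\<close>.\<close>

lemma dyadic_sup_infinite:
  fixes g :: "int \<Rightarrow> real^'n::finite \<Rightarrow> ennreal"
  assumes q: "0 < q" and c: "0 < c"
    and ge: "\<And>k x. 0 \<le> k \<Longrightarrow> x \<in> half_open_cube 0 1 \<Longrightarrow> ennreal c \<le> g k x"
  shows "dyadic_sup q g = \<infinity>"
proof -
  let ?P = "half_open_cube (0 :: real^'n) 1"
  let ?s = "\<lambda>x. \<Sum>\<^sub>\<infinity>k\<in>{k. - log 2 (side_length ?P) \<le> of_int k}. ennpowr (g k x) q"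
  have "?P \<in> dyadic_cubes"
    unfolding dyadic_cubes_def by (rule CollectI, rule exI[of _ "\<lambda>_. 0"], rule exI[of _ 0]) (simp add: zero_vec_def)
  moreover have "?s x = \<infinity>" if x: "x \<in> ?P" for x
  proof (rule infsum_superconst_infinite_ennreal)
    fix k :: int assume "k \<in> {k. - log 2 (side_length ?P) \<le> of_int k}"
    then have "0 \<le> k" by (simp add: side_length_half_open_cube)
    then have "ennpowr (ennreal c) q \<le> ennpowr (g k x) q"
      using x q by (intro ennpowr_mono ge) auto
    then show "ennreal (c powr q) \<le> ennpowr (g k x) q"
      using c by (simp add: ennpowr_ennreal)
  next
    show "infinite {k::int. - log 2 (side_length ?P) \<le> of_int k}"
      using infinite_Ici[of "0::int"] by (simp add: side_length_half_open_cube atLeast_def)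
  qed (use c in simp)
  moreover have "average ?P ?s = \<infinity>" if s: "\<And>x. x \<in> ?P \<Longrightarrow> ?s x = \<infinity>"
  proof -
    \<comment> \<open>Squeezing the half-open cube between closed ones shows that its measure is
      positive and finite, which is all that the quotient of infinity by it requires.\<close>
    have "cbox 0 (\<chi> i. 0 $ i + 1 / 2) \<subseteq> ?P"
      by (auto simp: half_open_cube_def mem_box_cart intro: le_less_trans[of _ "1 / 2"])
    moreover have "?P \<subseteq> cbox 0 (\<chi> i. 0 $ i + 1)"
      by (auto simp: half_open_cube_def mem_box_cart less_imp_le)
    ultimately have "emeasure lborel (cbox (0::real^'n) (\<chi> i. 0 $ i + 1 / 2)) \<le> emeasure lborel ?P"
       "emeasure lborel ?P \<le> emeasure lborel (cbox (0::real^'n) (\<chi> i. 0 $ i + 1))"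
      by (auto intro!: emeasure_mono)
    then have "emeasure lborel ?P \<noteq> 0" "emeasure lborel ?P \<noteq> \<infinity>"
      unfolding emeasure_lborel_cube[of "1/2", simplified] emeasure_lborel_cube[of 1, simplified]
      by (auto simp: top_unique)
    then have "\<infinity> * emeasure lborel ?P / emeasure lborel ?P = \<infinity>"
      by (simp add: ennreal_top_mult ennreal_top_divide)
    then show ?thesis
      using average_ge_const[of ?P ?P \<infinity> ?s] s by (simp add: top_unique)
  qed
  ultimately have "\<infinity> = ennpowr (average ?P ?s) (1 / q)" by (simp add: ennpowr_def)
  also have "\<dots> \<le> dyadic_sup q g"
    unfolding dyadic_sup_def using \<open>?P \<in> dyadic_cubes\<close> by (rule SUP_upper)
  finally show ?thesis by (simp add: top_unique)
qed

section \<open>Lower bounds for the maximal functions\<close>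

lemma wavelet_lower_bound:
  obtains \<delta> where "0 < \<delta>" "\<And>s. 1 / 2 \<le> s \<Longrightarrow> s \<le> 1 \<Longrightarrow> \<delta> \<le> \<bar>wavelet s\<bar>"
proof -
  obtain s0 where s0: "s0 \<in> {1/2..1}" "\<And>s. s \<in> {1/2..1} \<Longrightarrow> wavelet s0 \<le> wavelet s"
    using continuous_attains_inf[of "{1/2..1}" wavelet]
    by (auto simp: continuous_at_imp_continuous_on continuous_wavelet)
  show thesis
  proof
    show "0 < wavelet s0" using s0(1) sin_gt_zero_02[of s0] by (simp add: wavelet_def)
    show "wavelet s0 \<le> \<bar>wavelet s\<bar>" if "1 / 2 \<le> s" "s \<le> 1" for s
      using s0(2)[of s] that by auto
  qed
qed

text \<open>For \<open>1 \<le> l\<close> the cube \<open>?Q\<close> of side \<open>l\<close> at the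
  origin is admissible at every point of the unit cube. In its corner \<open>?R\<close> all rescaled
  coordinates lie in [1/2,1], where the profile stays away from zero.\<close>

lemma maximal_r_prod_wavelet_ge:
  assumes r: "0 < r"
  obtains c where "0 < c" "\<And>l (x::real^'n::finite). 1 \<le> l \<Longrightarrow> x \<in> half_open_cube 0 1 \<Longrightarrow>
     ennreal c \<le> maximal_r r (\<lambda>x. \<Prod>i\<in>UNIV. complex_of_real (wavelet (x $ i / l))) x"
proof -
  obtain \<delta> where \<delta>: "0 < \<delta>" "\<And>s. 1 / 2 \<le> s \<Longrightarrow> s \<le> 1 \<Longrightarrow> \<delta> \<le> \<bar>wavelet s\<bar>"
    using wavelet_lower_bound by blast
  let ?d = "CARD('n)"
  \<comment> \<open>The lower bound for the integrand on \<open>?R\<close>, times the proportion of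
    \<open>?Q\<close> that \<open>?R\<close> fills. Being free of \<open>l\<close>, it serves all
    dilations at once.\<close>
  define e where "e = (\<delta> ^ ?d) powr r / 2 ^ ?d"
  have e: "0 < e" using \<delta> by (simp add: e_def)
  show thesis
  proof
    show "0 < e powr (1 / r)" using e by simp
    fix l :: real and x :: "real^'n"
    assume l: "1 \<le> l" and x: "x \<in> half_open_cube 0 1"
    let ?f = "\<lambda>x::real^'n. \<Prod>i\<in>UNIV. complex_of_real (wavelet (x $ i / l))"
    let ?Q = "cbox 0 (\<chi> i. 0 $ i + l) :: (real^'n) set"
    let ?R = "cbox (\<chi> i. l / 2) (\<chi> i. (\<chi> i. l / 2) $ i + l / 2) :: (real^'n) set"
    let ?g = "\<lambda>y. ennreal (norm (norm (?f y) powr r))"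
    have "ennreal ((\<delta> ^ ?d) powr r) * emeasure lborel ?R / emeasure lborel ?Q \<le> average ?Q ?g"
    proof (rule average_ge_const)
      show "?R \<subseteq> ?Q" using l by (auto simp: mem_box_cart) (smt (verit) field_sum_of_halves)+
      fix y assume y: "y \<in> ?R"
      have "\<delta> ^ ?d = (\<Prod>i\<in>(UNIV::'n set). \<delta>)" by simp
      also have "\<dots> \<le> (\<Prod>i\<in>UNIV. \<bar>wavelet (y $ i / l)\<bar>)"
      proof (rule prod_mono, intro conjI \<delta>(2))
        fix i
        have "l / 2 \<le> y $ i" "y $ i \<le> l" using y by (auto simp: mem_box_cart)
        then show "1 / 2 \<le> y $ i / l" "y $ i / l \<le> 1" using l by (auto simp: field_simps)
      qed (use \<delta> in auto)
      also have "\<dots> = norm (?f y)" by (rule norm_prod_wavelet[symmetric])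
      finally have "(\<delta> ^ ?d) powr r \<le> norm (?f y) powr r"
        using \<delta> r by (intro powr_mono2) auto
      then show "ennreal ((\<delta> ^ ?d) powr r) \<le> ?g y" by (intro ennreal_leI) simp
    qed simp
    moreover have "ennreal ((\<delta> ^ ?d) powr r) * emeasure lborel ?R / emeasure lborel ?Q = ennreal e"
    proof -
      have "emeasure lborel ?R = ennreal ((l / 2) ^ ?d)" "emeasure lborel ?Q = ennreal (l ^ ?d)"
        using l by (intro emeasure_lborel_cube; simp)+
      then show ?thesis using l
        by (simp only:) (simp add: e_def divide_ennreal power_divide flip: ennreal_mult)
    qed
    moreover have "average ?Q ?g \<le> maximal (\<lambda>y. norm (?f y) powr r) x"
      unfolding maximal_def
    proof (rule SUP_upper, rule CollectI, rule conjI)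
      show "?Q \<in> cubes" unfolding cubes_def using l by (intro CollectI exI[of _ 0] exI[of _ l]) auto
      show "x \<in> ?Q" using x l by (auto simp: half_open_cube_def mem_box_cart intro: less_imp_le less_le_trans)
    qed
    ultimately have "ennreal e \<le> maximal (\<lambda>y. norm (?f y) powr r) x" by simp
    then have "ennpowr (ennreal e) (1 / r) \<le> maximal_r r ?f x"
      unfolding maximal_r_def using r by (intro ennpowr_mono) auto
    then show "ennreal (e powr (1 / r)) \<le> maximal_r r ?f x"
      using e by (simp add: ennpowr_ennreal)
  qed
qed

section \<open>The sequence and its three properties\<close>

theorem theorem1p1:
  fixes r q :: real
  assumes "0 < r" and "0 < q"
  shows "\<exists>f :: int \<Rightarrow> real^'n::finite \<Rightarrow> complex.
    (\<forall>k. f k \<in> band_limited (2 powi k)) \<and>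
    dyadic_sup q (\<lambda>k x. ennreal (norm (f k x))) < \<infinity> \<and>
    dyadic_sup q (\<lambda>k. maximal_r r (f k)) = \<infinity>"
proof -
  define d where "d = real CARD('n)"
  have d: "1 \<le> d" by (simp add: d_def Suc_le_eq)
  \<comment> \<open>For \<open>k < 0\<close> the dilated spectrum would widen while the band
    narrows. Zero is harmless there, since the divergence is tested on the unit cube, which involves
    only \<open>k \<ge> 0\<close>.\<close>
  define f :: "int \<Rightarrow> real^'n \<Rightarrow> complex" where
    "f k = (if 0 \<le> k then \<lambda>x. \<Prod>i\<in>UNIV. of_real (wavelet (x $ i / (d * 2 powi k))) else (\<lambda>_. 0))" for k
  have "f k \<in> band_limited (2 powi k)" for k
    using band_limited_wavelet[of "nat k", where 'n = 'n]
    by (simp add: f_def band_limited_zero power_int_def d_def)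
  moreover have "dyadic_sup q (\<lambda>k x. ennreal (norm (f k x))) < \<infinity>"
  proof (rule dyadic_sup_finite[OF assms(2)])
    fix x :: "real^'n" and F :: "int set"
    assume F: "finite F"
    \<comment> \<open>Any coordinate will do: the decay in \<open>k\<close> of a single factor
      controls the product, and the constant \<open>d\<close> is absorbed into the point
      \<open>x $ j / d\<close>.\<close>
    obtain j :: 'n where True by simp
    have le: "norm (f k x) \<le> \<bar>wavelet (x $ j / d / 2 powi k)\<bar>" for k
    proof (cases "0 \<le> k")
      case True
      have "norm (f k x) = (\<Prod>i\<in>UNIV. \<bar>wavelet (x $ i / (d * 2 powi k))\<bar>)"
        using True by (simp add: f_def norm_prod_wavelet)
      also have "\<dots> = \<bar>wavelet (x $ j / (d * 2 powi k))\<bar> * (\<Prod>i\<in>UNIV - {j}. \<bar>wavelet (x $ i / (d * 2 powi k))\<bar>)"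
        by (rule prod.remove) auto
      also have "\<dots> \<le> \<bar>wavelet (x $ j / (d * 2 powi k))\<bar> * 1"
        by (intro mult_left_mono prod_le_1) (auto simp: wavelet_le)
      finally show ?thesis by simp
    qed (simp add: f_def)
    have "(\<Sum>k\<in>F. ennpowr (ennreal (norm (f k x))) q) = ennreal (\<Sum>k\<in>F. norm (f k x) powr q)"
      by (simp add: ennpowr_ennreal)
    also have "\<dots> \<le> ennreal (\<Sum>k\<in>F. \<bar>wavelet (x $ j / d / 2 powi k)\<bar> powr q)"
      using assms(2) by (intro ennreal_leI sum_mono powr_mono2 le) auto
    also have "\<dots> \<le> ennreal (2 powr q * (2 / (1 - (1 / 2) powr q)))"
      by (intro ennreal_leI wavelet_dyadic_sum_bounded assms F)
    finally show "(\<Sum>k\<in>F. ennpowr (ennreal (norm (f k x))) q) \<le> ennreal (2 powr q * (2 / (1 - (1 / 2) powr q)))" .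
  qed
  moreover have "dyadic_sup q (\<lambda>k. maximal_r r (f k)) = \<infinity>"
  proof -
    obtain c where c: "0 < c" "\<And>l (x::real^'n). 1 \<le> l \<Longrightarrow> x \<in> half_open_cube 0 1 \<Longrightarrow>
       ennreal c \<le> maximal_r r (\<lambda>x. \<Prod>i\<in>UNIV. complex_of_real (wavelet (x $ i / l))) x"
      using maximal_r_prod_wavelet_ge[OF assms(1), where 'n = 'n] by blast
    have "1 \<le> d * 2 powi k" if "0 \<le> k" for k
      using mult_mono[OF d, of 1 "2 powi k"] d that by (simp add: power_int_def)
    then show ?thesis
      using c by (intro dyadic_sup_infinite[OF assms(2) c(1)]) (simp add: f_def)
  qed
  ultimately show ?thesis by blast
qed

end
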